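(* Let $\le$ be a binary relation on a set $S$ and let $\Upsilon,\Theta\subseteq S^S$. Suppose $\Theta$ is a subsemigroup of $(S^S,\circ)$ and there is $\sigma\in\Upsilon$ such that either $\Theta\circ\sigma\subseteq\Theta$ or $\sigma\circ\Theta\subseteq\Theta$. Then $\le^{\mathrm{cor}}_{\Upsilon,\Theta}$ is a $(\Upsilon,\Theta)$-correct augmentation of $\le$.
   Context: $S^S$ is the set of all functions $S\to S$; $\Theta\circ\sigma=\{\tau\circ\sigma:\tau\in\Theta\}$ and $\sigma\circ\Theta=\{\sigma\circ\tau:\tau\in\Theta\}$. An augmentation of $\le$ is a relation on $S$ containing $\le$. A relation $\preceq$ on $S$ is $(\Upsilon,\Theta)$-correct if for all $p,q\in S$ with $p\not\preceq q$ there is $\sigma\in\Upsilon$ such that $\tau(\sigma(p))\not\preceq\tau(\sigma(q))$ for all $\tau\in\Theta$. The $(\Upsilon,\Theta)$-corrective augmentation is defined by: $p\le^{\mathrm{cor}}_{\Upsilon,\Theta}q$ iff $p\le q$ or for every $\sigma\in\Upsilon$ there is $\tau\in\Theta$ with $\tau(\sigma(p))\le\tau(\sigma(q))$. *)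

theory Defs
  imports Main "HOL-Library.FuncSet"
begin

text \<open>
  The set of all functions from a set \<open>S\<close> to itself is \<open>S \<rightarrow>\<^sub>E S\<close>, with composition
  \<open>compose S\<close>; extensionality makes equality of functions agreement on \<open>S\<close>.
  A binary relation on \<open>S\<close> is a subset of \<open>S \<times> S\<close>.
\<close>

text \<open>The empty set counts as a subsemigroup.\<close>

definition subsemigroup :: "'a set \<Rightarrow> ('a \<Rightarrow> 'a) set \<Rightarrow> bool" where
  "subsemigroup S \<Theta> \<longleftrightarrow>
     \<Theta> \<subseteq> (S \<rightarrow>\<^sub>E S) \<and> (\<forall>\<tau>\<in>\<Theta>. \<forall>\<tau>'\<in>\<Theta>. compose S \<tau> \<tau>' \<in> \<Theta>)"

definition augmentation :: "'a set \<Rightarrow> 'a rel \<Rightarrow> 'a rel \<Rightarrow> bool" where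
  "augmentation S r r' \<longleftrightarrow> r' \<subseteq> S \<times> S \<and> r \<subseteq> r'"

definition correct :: "'a set \<Rightarrow> ('a \<Rightarrow> 'a) set \<Rightarrow> ('a \<Rightarrow> 'a) set \<Rightarrow> 'a rel \<Rightarrow> bool" where
  "correct S \<Upsilon> \<Theta> r \<longleftrightarrow>
     (\<forall>p\<in>S. \<forall>q\<in>S. (p, q) \<notin> r \<longrightarrow> (\<exists>\<sigma>\<in>\<Upsilon>. \<forall>\<tau>\<in>\<Theta>. (\<tau> (\<sigma> p), \<tau> (\<sigma> q)) \<notin> r))"

definition corrective_augmentation ::
    "'a set \<Rightarrow> ('a \<Rightarrow> 'a) set \<Rightarrow> ('a \<Rightarrow> 'a) set \<Rightarrow> 'a rel \<Rightarrow> 'a rel" where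
  "corrective_augmentation S \<Upsilon> \<Theta> r =
     {(p, q) \<in> S \<times> S. (p, q) \<in> r \<or> (\<forall>\<sigma>\<in>\<Upsilon>. \<exists>\<tau>\<in>\<Theta>. (\<tau> (\<sigma> p), \<tau> (\<sigma> q)) \<in> r)}"

end

theory Submission
  imports Defs
begin

text \<open>The point is that a \<sigma> separating p from q for the original relation also
  separates them for the augmented one. Let \<rho> be the element of \<Upsilon> given by the
  absorption hypothesis. If some \<tau> in \<Theta> made \<tau>(\<sigma>(p)) and \<tau>(\<sigma>(q))
  related in the augmentation but not in \<open>r\<close>, testing this at \<rho> would give \<tau>'
  in \<Theta> such that \<tau>' \<rho> \<tau> carries \<sigma>(p), \<sigma>(q) to a pair in
  \<open>r\<close>. But \<tau>' \<rho> \<tau> lies in \<Theta>, by either form of absorption, so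
  this contradicts the choice of \<sigma>.\<close>

theorem lemma3p83:
  fixes S :: "'a set" and r :: "'a rel" and \<Upsilon> \<Theta> :: "('a \<Rightarrow> 'a) set"
  assumes "r \<subseteq> S \<times> S"
    and "\<Upsilon> \<subseteq> (S \<rightarrow>\<^sub>E S)"
    and "\<Theta> \<subseteq> (S \<rightarrow>\<^sub>E S)"
    and "subsemigroup S \<Theta>"
    and "\<exists>\<sigma>\<in>\<Upsilon>. {compose S \<tau> \<sigma> | \<tau>. \<tau> \<in> \<Theta>} \<subseteq> \<Theta> \<or> {compose S \<sigma> \<tau> | \<tau>. \<tau> \<in> \<Theta>} \<subseteq> \<Theta>"
  shows "augmentation S r (corrective_augmentation S \<Upsilon> \<Theta> r) \<and>
         correct S \<Upsilon> \<Theta> (corrective_augmentation S \<Upsilon> \<Theta> r)"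
proof
  show "augmentation S r (corrective_augmentation S \<Upsilon> \<Theta> r)"
    using assms(1) by (auto simp: augmentation_def corrective_augmentation_def)
next
  let ?c = "corrective_augmentation S \<Upsilon> \<Theta> r"
  obtain \<rho> where \<rho>: "\<rho> \<in> \<Upsilon>"
    and absorb: "(\<forall>\<tau>\<in>\<Theta>. compose S \<tau> \<rho> \<in> \<Theta>) \<or> (\<forall>\<tau>\<in>\<Theta>. compose S \<rho> \<tau> \<in> \<Theta>)"
    using assms(5) by blast
  have mult: "compose S \<tau> \<tau>' \<in> \<Theta>" if "\<tau> \<in> \<Theta>" "\<tau>' \<in> \<Theta>" for \<tau> \<tau>'
    using assms(4) that by (auto simp: subsemigroup_def)
  \<comment> \<open>The product is bracketed so that \<rho> is absorbed by the neighbour the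
    hypothesis allows: (\<tau>' \<rho>) \<tau> or \<tau>' (\<rho> \<tau>). Stating only agreement on
    \<open>S\<close> hides which bracketing was used.\<close>
  have sandwich: "\<exists>\<theta>\<in>\<Theta>. \<forall>x\<in>S. \<theta> x = \<tau>' (\<rho> (\<tau> x))" if "\<tau>' \<in> \<Theta>" "\<tau> \<in> \<Theta>" for \<tau>' \<tau>
    using absorb
  proof
    assume "\<forall>\<tau>\<in>\<Theta>. compose S \<tau> \<rho> \<in> \<Theta>"
    with that have "compose S (compose S \<tau>' \<rho>) \<tau> \<in> \<Theta>" by (simp add: mult)
    \<comment> \<open>Here the inner \<open>compose S\<close> is evaluated at
      \<open>\<tau> x\<close>, and it unfolds to \<open>\<tau>' (\<rho> (\<tau> x))\<close> only for
      arguments in \<open>S\<close>.\<close>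
    moreover have "\<tau> x \<in> S" if "x \<in> S" for x
      using \<open>\<tau> \<in> \<Theta>\<close> assms(3) that by auto
    ultimately show ?thesis by (auto simp: compose_def intro: bexI[rotated])
  next
    assume "\<forall>\<tau>\<in>\<Theta>. compose S \<rho> \<tau> \<in> \<Theta>"
    with that have "compose S \<tau>' (compose S \<rho> \<tau>) \<in> \<Theta>" by (simp add: mult)
    then show ?thesis by (auto simp: compose_def intro: bexI[rotated])
  qed
  show "correct S \<Upsilon> \<Theta> ?c"
    unfolding correct_def
  proof (intro ballI impI)
    fix p q assume "p \<in> S" "q \<in> S" "(p, q) \<notin> ?c"
    then obtain \<sigma> where \<sigma>: "\<sigma> \<in> \<Upsilon>" and sep: "\<And>\<tau>. \<tau> \<in> \<Theta> \<Longrightarrow> (\<tau> (\<sigma> p), \<tau> (\<sigma> q)) \<notin> r"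
      by (auto simp: corrective_augmentation_def)
    have S: "\<sigma> p \<in> S" "\<sigma> q \<in> S"
      using \<sigma> assms(2) \<open>p \<in> S\<close> \<open>q \<in> S\<close> by auto
    have "(\<tau> (\<sigma> p), \<tau> (\<sigma> q)) \<notin> ?c" if "\<tau> \<in> \<Theta>" for \<tau>
    proof
      assume "(\<tau> (\<sigma> p), \<tau> (\<sigma> q)) \<in> ?c"
      \<comment> \<open>\<open>sep\<close> excludes the disjunct in \<open>r\<close>, so the
        universal disjunct holds and is instantiated at \<rho>.\<close>
      with sep[OF that] \<rho> obtain \<tau>' where "\<tau>' \<in> \<Theta>"
        and le: "(\<tau>' (\<rho> (\<tau> (\<sigma> p))), \<tau>' (\<rho> (\<tau> (\<sigma> q)))) \<in> r"
        by (auto simp: corrective_augmentation_def)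
      then obtain \<theta> where "\<theta> \<in> \<Theta>" "\<forall>x\<in>S. \<theta> x = \<tau>' (\<rho> (\<tau> x))"
        using sandwich \<open>\<tau> \<in> \<Theta>\<close> by blast
      with sep[of \<theta>] S le show False by simp
    qed
    with \<sigma> show "\<exists>\<sigma>\<in>\<Upsilon>. \<forall>\<tau>\<in>\<Theta>. (\<tau> (\<sigma> p), \<tau> (\<sigma> q)) \<notin> ?c" by blast
  qed
qed

end
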